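(* Let $u$ be a sufficiently smooth solution of $$u_t-u_{txx}+3u^2u_x=uu_{xxx}+2u_xu_{xx}$$ such that $u(t,x)$ and its derivatives up to second order go to $0$ as $x\to\pm\infty$, and let $u_0:=u(0,x)$. Then the functionals $$\mathcal{H}_0[u]=\int_{\mathbb{R}}u\,dx,\qquad \mathcal{H}[u]=\frac{1}{2}\int_{\mathbb{R}}(u^2+u_x^2)\,dx,\qquad \mathcal{H}_1[u]=\int_{\mathbb{R}}\left(\frac{1}{4}u^{4}+\frac{1}{2}uu_{x}^{2}\right)dx$$ are independent of $t$. In particular, $\mathcal{H}_0[u]=\mathcal{H}_0[u_0]$ and $\mathcal{H}[u]=\mathcal{H}[u_0]$.
   Context: Here $u=u(t,x)$ with $x\in\mathbb{R}$, and subscripts $t$ and $x$ denote partial derivatives. *)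

theory Defs
  imports "HOL-Analysis.Analysis"
begin

(* A function u of time t in I and space x is curried, so that u t is the spatial profile at time t.
   The time derivative is taken within the time interval I, hence is one-sided at an end point
   of I that belongs to I. *)

definition pd_t :: "real set \<Rightarrow> (real \<Rightarrow> real \<Rightarrow> real) \<Rightarrow> real \<Rightarrow> real \<Rightarrow> real" where
  "pd_t I u t x = vector_derivative (\<lambda>s. u s x) (at t within I)"

definition pd_x :: "(real \<Rightarrow> real \<Rightarrow> real) \<Rightarrow> real \<Rightarrow> real \<Rightarrow> real" where
  "pd_x u t x = deriv (u t) x"

(* C_on k I u: all partial derivatives of u of order up to k, in any order of differentiation,
   exist on I \<times> UNIV and are jointly continuous there. *)

primrec C_on :: "nat \<Rightarrow> real set \<Rightarrow> (real \<Rightarrow> real \<Rightarrow> real) \<Rightarrow> bool" where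
  "C_on 0 I u \<longleftrightarrow> continuous_on (I \<times> UNIV) (\<lambda>(t, x). u t x)"
| "C_on (Suc k) I u \<longleftrightarrow>
     continuous_on (I \<times> UNIV) (\<lambda>(t, x). u t x) \<and>
     (\<forall>t\<in>I. \<forall>x. (\<lambda>s. u s x) differentiable (at t within I) \<and> u t differentiable (at x)) \<and>
     C_on k I (pd_t I u) \<and> C_on k I (pd_x u)"

definition solves_equation :: "real set \<Rightarrow> (real \<Rightarrow> real \<Rightarrow> real) \<Rightarrow> bool" where
  "solves_equation I u \<longleftrightarrow> (\<forall>t\<in>I. \<forall>x.
     pd_t I u t x - pd_x (pd_x (pd_t I u)) t x + 3 * (u t x)\<^sup>2 * pd_x u t x
     = u t x * pd_x (pd_x (pd_x u)) t x + 2 * pd_x u t x * pd_x (pd_x u) t x)"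

(* The decay is pointwise in t: no uniformity in time is required. *)

definition vanishes_at_infinity_upto ::
    "nat \<Rightarrow> real set \<Rightarrow> (real \<Rightarrow> real \<Rightarrow> real) \<Rightarrow> bool" where
  "vanishes_at_infinity_upto k I u \<longleftrightarrow> (\<forall>i j. i + j \<le> k \<longrightarrow> (\<forall>t\<in>I.
     (((pd_t I ^^ i) ((pd_x ^^ j) u)) t \<longlongrightarrow> 0) at_top \<and>
     (((pd_t I ^^ i) ((pd_x ^^ j) u)) t \<longlongrightarrow> 0) at_bot))"

(* The functionals act on spatial profiles v. Lebesgue integrals of non-integrable functions
   are 0 by convention; integrability is stated separately where it matters. *)

definition H0_functional :: "(real \<Rightarrow> real) \<Rightarrow> real" where
  "H0_functional v = (LINT x|lborel. v x)"

definition H_functional :: "(real \<Rightarrow> real) \<Rightarrow> real" where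
  "H_functional v = 1/2 * (LINT x|lborel. (v x)\<^sup>2 + (deriv v x)\<^sup>2)"

definition H1_functional :: "(real \<Rightarrow> real) \<Rightarrow> real" where
  "H1_functional v = (LINT x|lborel. 1/4 * (v x)^4 + 1/2 * v x * (deriv v x)\<^sup>2)"

end

theory Submission
  imports Defs
begin

text \<open>
  Each of the three densities satisfies a local law \<open>h_t = J_x\<close>, and each flux \<open>J\<close> vanishes as
  \<open>x \<rightarrow> \<plusminus>\<infinity>\<close>. Integrated over \<open>[s, t] \<times> [- R, R]\<close> such a law says that \<open>\<integral> h(t) - \<integral> h(s)\<close> over \<open>[- R, R]\<close>
  is the time integral of the flux through \<open>\<plusminus> R\<close>. The difficulty is that the decay of the flux is
  pointwise in time, so the limit \<open>R \<rightarrow> \<infinity>\<close> may not be taken under the time integral without a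
  bound that is uniform in time.

  Such a bound comes from the energy \<open>E(t) = \<integral> u\<^sup>2 + u_x\<^sup>2\<close>. Put
  \<open>w = u u_xx + u_x\<^sup>2 / 2 - u\<^sup>3 + u_tx + u\<^sup>2 / 2\<close>. The equation gives \<open>w_x = u_t + u u_x\<close> and hence
  \<open>w - w_xx = u\<^sup>2 / 2 - u_x\<^sup>2 / 2 - u\<^sup>3\<close>. The right-hand side is bounded in \<open>L\<^sup>1\<close> by the energy, and
  \<open>w\<close>, \<open>w_x\<close> vanish at infinity; factoring \<open>1 - \<partial>\<^sup>2 = (1 - \<partial>) (1 + \<partial>)\<close> then bounds \<open>w\<close> and \<open>w_x\<close>
  uniformly in terms of \<open>E(t)\<close> (\<open>resolvent_bound\<close>). In terms of \<open>u, u_x, w, w_x\<close> the laws are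

  \<^item> \<open>\<partial>\<^sub>t u = \<partial>\<^sub>x (w - u\<^sup>2 / 2)\<close>,

  \<^item> \<open>\<partial>\<^sub>t (u\<^sup>2 + u_x\<^sup>2) = \<partial>\<^sub>x (2 u w - u\<^sup>3 + u\<^sup>4 / 2 - u u_x\<^sup>2)\<close>,

  \<^item> \<open>\<partial>\<^sub>t (u\<^sup>4 / 4 + u u_x\<^sup>2 / 2) = \<partial>\<^sub>x (w_x\<^sup>2 / 2 - (w - u\<^sup>2 / 2)\<^sup>2 / 2 - u\<^sup>2 u_x\<^sup>2 / 2)\<close>.

  The fluxes are bounded by the energy except for the terms with \<open>u_x\<^sup>2\<close>, which are bounded only after
  integration over an interval of length one. Averaging the cut-off \<open>R\<close> over \<open>[n, n + 1]\<close> therefore makes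
  dominated convergence in time applicable, and each integral is conserved on any time interval on
  which \<open>E\<close> is bounded (\<open>conserved_while_energy_bounded\<close>).

  It remains to exclude that \<open>E\<close> is unbounded near some time, which pointwise finiteness alone does
  not do. By Fatou's lemma \<open>E\<close> is lower semicontinuous, and it is constant on every interval on which it
  is bounded. A Baire category argument shows that these two properties force \<open>E\<close> to be constant
  (\<open>constant_if_lsc_and_constant_where_bounded\<close>). With \<open>E\<close> constant the other two integrals are
  conserved on all of \<open>I\<close>.
\<close>

section \<open>Lower semicontinuous functions that are constant where they are bounded\<close>

lemma bounded_if_locally_bounded:
  fixes H :: "real \<Rightarrow> real"
  assumes "\<And>t. t \<in> {a..b} \<Longrightarrow> \<exists>e>0. \<exists>M. \<forall>r\<in>{a..b} \<inter> ball t e. H r \<le> M"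
  shows "\<exists>M. \<forall>r\<in>{a..b}. H r \<le> M"
proof -
  obtain e M where e: "\<And>t. t \<in> {a..b} \<Longrightarrow> e t > 0"
    and M: "\<And>t r. t \<in> {a..b} \<Longrightarrow> r \<in> {a..b} \<inter> ball t (e t) \<Longrightarrow> H r \<le> M t"
    using assms by metis
  have "{a..b} \<subseteq> (\<Union>t\<in>{a..b}. ball t (e t))"
    using e by (auto intro!: bexI)
  then obtain F where F: "F \<subseteq> {a..b}" "finite F" "{a..b} \<subseteq> (\<Union>t\<in>F. ball t (e t))"
    using compactE_image[OF compact_Icc, of "{a..b}" "\<lambda>t. ball t (e t)"] by (metis open_ball)
  have "H r \<le> (\<Sum>t\<in>F. \<bar>M t\<bar>)" if r: "r \<in> {a..b}" for r
  proof -
    obtain t where t: "t \<in> F" "r \<in> ball t (e t)" using subsetD[OF F(3) r] by blast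
    then have "H r \<le> M t" using M[of t r] F(1) r by blast
    then have "H r \<le> \<bar>M t\<bar>" by linarith
    also have "\<dots> \<le> (\<Sum>t\<in>F. \<bar>M t\<bar>)"
      by (rule member_le_sum) (use t F in auto)
    finally show ?thesis .
  qed
  then show ?thesis by blast
qed

text \<open>
  On the open interval \<open>H\<close> has a single value by compactness. Lower semicontinuity extends this value as
  an upper bound to the two end points, so \<open>H\<close> is bounded on the closed interval as well: nothing can jump
  at an end point.
\<close>

lemma eq_at_endpoints_if_locally_bounded_between:
  fixes H :: "real \<Rightarrow> real"
  assumes lsc: "\<And>M. closed {t\<in>{a..b}. H t \<le> M}"
    and eq: "\<And>s t M. \<lbrakk>a \<le> s; s < t; t \<le> b; \<And>r. r \<in> {s..t} \<Longrightarrow> H r \<le> M\<rbrakk> \<Longrightarrow> H s = H t"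
    and cd: "a \<le> c" "c < d" "d \<le> b"
    and loc: "\<And>t. t \<in> {c<..<d} \<Longrightarrow> \<exists>e>0. \<exists>M. \<forall>r\<in>{a..b} \<inter> ball t e. H r \<le> M"
  shows "H c = H d"
proof -
  have const: "H s = H t" if "c < s" "s < t" "t < d" for s t
  proof -
    have "\<exists>e>0. \<exists>M. \<forall>r\<in>{s..t} \<inter> ball x e. H r \<le> M" if x: "x \<in> {s..t}" for x
    proof -
      obtain e M where "e > 0" "\<forall>r\<in>{a..b} \<inter> ball x e. H r \<le> M"
        using loc[of x] x \<open>c < s\<close> \<open>t < d\<close> by auto
      moreover have "{s..t} \<subseteq> {a..b}" using that cd \<open>c < s\<close> \<open>t < d\<close> by auto
      ultimately show ?thesis by (meson Int_iff subsetD)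
    qed
    then obtain M where "\<forall>r\<in>{s..t}. H r \<le> M"
      using bounded_if_locally_bounded by blast
    then show ?thesis using eq[of s t M] that cd by auto
  qed
  define m where "m = (c + d) / 2"
  define h where "h = H m"
  have m: "c < m" "m < d" using cd by (auto simp: m_def)
  have h: "H t = h" if t: "c < t" "t < d" for t
  proof -
    consider "t < m" | "t = m" | "m < t" by linarith
    then show ?thesis
    proof cases
      case 1
      then show ?thesis unfolding h_def using const[OF t(1) 1 m(2)] by blast
    next
      case 2
      then show ?thesis unfolding h_def by blast
    next
      case 3
      then show ?thesis unfolding h_def using const[OF m(1) 3 t(2)] by argo
    qed
  qed
  have "{c<..<d} \<subseteq> {t\<in>{a..b}. H t \<le> h}" using h cd by auto
  then have "closure {c<..<d} \<subseteq> {t\<in>{a..b}. H t \<le> h}"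
    using lsc by (rule closure_minimal)
  then have "\<And>r. r \<in> {c..d} \<Longrightarrow> H r \<le> h" using cd by auto
  then show ?thesis using eq[of c d h] cd by blast
qed

text \<open>
  Let \<open>K\<close> be the closed set of points near which \<open>H\<close> is unbounded. If \<open>K\<close> is nonempty, it is the union of
  the relatively closed sets \<open>K \<inter> {H \<le> n}\<close>, so by Baire's theorem one of these contains \<open>K \<inter> ball p e\<close> for some
  \<open>p\<close> in \<open>K\<close>. A point of the ball outside \<open>K\<close> lies in a gap of \<open>K\<close> with an end point in \<open>K \<inter> ball p e\<close>,
  and \<open>H\<close> has the same value at both. So \<open>H \<le> n\<close> on the whole ball, contradicting \<open>p \<in> K\<close>.
\<close>

lemma constant_if_lsc_and_constant_where_bounded:
  fixes H :: "real \<Rightarrow> real"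
  assumes "a < b"
    and lsc: "\<And>M. closed {t\<in>{a..b}. H t \<le> M}"
    and eq: "\<And>s t M. \<lbrakk>a \<le> s; s < t; t \<le> b; \<And>r. r \<in> {s..t} \<Longrightarrow> H r \<le> M\<rbrakk> \<Longrightarrow> H s = H t"
  shows "H a = H b"
proof -
  define loc where "loc t \<longleftrightarrow> (\<exists>e>0. \<exists>M. \<forall>r\<in>{a..b} \<inter> ball t e. H r \<le> M)" for t
  define K where "K = {t\<in>{a..b}. \<not> loc t}"
  have across: "H c = H d" if "a \<le> c" "c < d" "d \<le> b" "{c<..<d} \<inter> K = {}" for c d
  proof (rule eq_at_endpoints_if_locally_bounded_between[OF lsc eq that(1-3)])
    fix t assume "t \<in> {c<..<d}"
    moreover from this have "t \<in> {a..b}" using that by auto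
    ultimately show "\<exists>e>0. \<exists>M. \<forall>r\<in>{a..b} \<inter> ball t e. H r \<le> M"
      using that(4) unfolding K_def loc_def by blast
  qed
  have "closed K"
  proof -
    have "open {t. loc t}"
      unfolding open_contains_ball
    proof
      fix t assume "t \<in> {t. loc t}"
      then obtain e M where e: "e > 0" and M: "\<And>r. r \<in> {a..b} \<inter> ball t e \<Longrightarrow> H r \<le> M"
        unfolding loc_def by blast
      have "loc s" if s: "s \<in> ball t e" for s
      proof -
        obtain d where "d > 0" "ball s d \<subseteq> ball t e"
          using s by (rule openE[OF open_ball])
        then show ?thesis unfolding loc_def using M by blast
      qed
      then show "\<exists>e>0. ball t e \<subseteq> {t. loc t}" using e by auto
    qed
    moreover have "K = {a..b} \<inter> - {t. loc t}" unfolding K_def by auto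
    ultimately show ?thesis using closed_Int[OF closed_atLeastAtMost closed_Compl] by metis
  qed
  have "K = {}"
  proof (rule ccontr)
    assume "K \<noteq> {}"
    define G where "G = range (\<lambda>n::nat. {t\<in>K. real n < H t})"
    have G_open: "openin (top_of_set K) T" if T: "T \<in> G" for T
    proof -
      obtain n :: nat where "T = {t\<in>K. real n < H t}" using T unfolding G_def by blast
      then have "T = K \<inter> - {t\<in>{a..b}. H t \<le> real n}" unfolding K_def by auto
      then show ?thesis using openin_open_Int[OF open_Compl[OF lsc]] by simp
    qed
    have "\<Inter>G = {}"
    proof -
      have "x \<notin> \<Inter>G" for x
        using real_arch_simple[of "H x"] unfolding G_def by (auto simp: not_less)
      then show ?thesis by blast
    qed
    then have "\<not> K \<subseteq> closure (\<Inter>G)" using \<open>K \<noteq> {}\<close> by simp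
    moreover have "countable G" unfolding G_def by simp
    ultimately obtain T where "T \<in> G" "\<not> K \<subseteq> closure T"
      using Baire[OF \<open>closed K\<close>, of G] G_open by blast
    then obtain n :: nat and p where p: "p \<in> K" "p \<notin> closure {t\<in>K. real n < H t}"
      unfolding G_def by blast
    then obtain e where "e > 0" and far: "\<And>t. t \<in> {t\<in>K. real n < H t} \<Longrightarrow> \<not> dist t p < e"
      unfolding closure_approachable by blast
    have e: "H t \<le> real n" if "t \<in> K" "t \<in> ball p e" for t
    proof -
      have "\<not> real n < H t" using far[of t] that by (auto simp: dist_commute)
      then show ?thesis by simp
    qed
    have "H t \<le> real n" if t: "t \<in> {a..b}" "t \<in> ball p e" for t
    proof -
      consider "t \<in> K" | "t \<notin> K" "p < t" | "t \<notin> K" "t < p"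
        using p(1) by (metis linorder_less_linear)
      then show ?thesis
      proof cases
        case 1
        then show ?thesis using e t by blast
      next
        case 2
        \<comment> \<open>\<open>c\<close> is the end point, nearest to \<open>t\<close>, of the gap of \<open>K\<close> that contains \<open>t\<close>.\<close>
        have comp: "compact (K \<inter> {p..t})" using \<open>closed K\<close> by (simp add: closed_Int_compact)
        obtain c where c: "c \<in> K \<inter> {p..t}" "\<And>r. r \<in> K \<inter> {p..t} \<Longrightarrow> r \<le> c"
          using compact_attains_sup[OF comp] p 2 by force
        have "c < t" using c 2 by (metis IntD1 IntD2 atLeastAtMost_iff order_less_le)
        moreover have "{c<..<t} \<inter> K = {}" using c by fastforce
        ultimately have "H c = H t" using across[of c t] c t K_def by auto
        moreover have "c \<in> ball p e" using c t by (auto simp: dist_real_def)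
        ultimately show ?thesis using e c by force
      next
        case 3
        have comp: "compact (K \<inter> {t..p})" using \<open>closed K\<close> by (simp add: closed_Int_compact)
        obtain c where c: "c \<in> K \<inter> {t..p}" "\<And>r. r \<in> K \<inter> {t..p} \<Longrightarrow> c \<le> r"
          using compact_attains_inf[OF comp] p 3 by force
        have "t < c" using c 3 by (metis IntD1 IntD2 atLeastAtMost_iff order_less_le)
        moreover have "{t<..<c} \<inter> K = {}" using c by fastforce
        ultimately have "H t = H c" using across[of t c] c t K_def by auto
        moreover have "c \<in> ball p e" using c t by (auto simp: dist_real_def)
        ultimately show ?thesis using e c by force
      qed
    qed
    then have "loc p" unfolding loc_def using \<open>e > 0\<close> by blast
    then show False using p K_def by auto
  qed
  then show ?thesis using across[of a b] \<open>a < b\<close> by auto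
qed

section \<open>Local conservation laws on the line\<close>

lemma tendsto_integral_symmetric_interval:
  fixes f :: "real \<Rightarrow> real"
  assumes "integrable lborel f"
  shows "((\<lambda>R. integral {-R..R} f) \<longlongrightarrow> (LINT x|lborel. f x)) at_top"
proof (rule tendsto_at_topI_sequentially)
  fix X :: "nat \<Rightarrow> real" assume X: "filterlim X at_top sequentially"
  have "(\<lambda>n. LINT x|lborel. indicator {-X n..X n} x *\<^sub>R f x) \<longlonglongrightarrow> (LINT x|lborel. f x)"
  proof (rule integral_dominated_convergence)
    show "integrable lborel (\<lambda>x. norm (f x))" using assms by simp
    show "AE x in lborel. (\<lambda>n. indicator {-X n..X n} x *\<^sub>R f x) \<longlonglongrightarrow> f x"
    proof
      fix x
      have "\<forall>\<^sub>F n in sequentially. indicator {-X n..X n} x *\<^sub>R f x = f x"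
        using filterlim_at_top[THEN iffD1, OF X, rule_format, of "\<bar>x\<bar>"]
        by eventually_elim (auto simp: indicator_def)
      then show "(\<lambda>n. indicator {-X n..X n} x *\<^sub>R f x) \<longlonglongrightarrow> f x"
        by (rule tendsto_eventually)
    qed
  qed (use assms in \<open>auto split: split_indicator\<close>)
  moreover have "(LINT x|lborel. indicator {-R..R} x *\<^sub>R f x) = integral {-R..R} f" for R
    using set_borel_integral_eq_integral(2)[of "{-R..R}" f]
      integrable_mult_indicator[OF _ assms, of "{-R..R}"]
    by (simp add: set_integrable_def set_lebesgue_integral_def)
  ultimately show "(\<lambda>n. integral {-X n..X n} f) \<longlonglongrightarrow> (LINT x|lborel. f x)" by simp
qed

lemma integral_Icc_le_LINT:
  fixes f :: "real \<Rightarrow> real"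
  assumes "integrable lborel f" and "\<And>x. 0 \<le> f x"
  shows "integral {a..b} f \<le> (LINT x|lborel. f x)"
proof -
  have "f integrable_on UNIV" "integral UNIV f = (LINT x|lborel. f x)"
    using has_integral_integral_lborel[OF assms(1)] by (auto simp: integrable_on_def)
  moreover have "f integrable_on {a..b}"
    using \<open>f integrable_on UNIV\<close> integrable_on_subinterval[of f UNIV a b] by simp
  ultimately show ?thesis
    using integral_subset_le[of "{a..b}" UNIV f] assms by auto
qed

lemma moving_average_tendsto:
  fixes f :: "real \<Rightarrow> real"
  assumes "continuous_on UNIV f" and "(f \<longlongrightarrow> L) at_top"
  shows "(\<lambda>n. integral {real n..real n + 1} f) \<longlonglongrightarrow> L"
proof (rule LIMSEQ_I)
  fix e :: real assume "e > 0"
  then obtain N where N: "\<And>x. x \<ge> N \<Longrightarrow> \<bar>f x - L\<bar> < e/2"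
    using assms(2) unfolding tendsto_iff eventually_at_top_linorder dist_real_def
    by (meson half_gt_zero)
  obtain n0 :: nat where n0: "real n0 \<ge> N" using real_arch_simple by blast
  have "norm (integral {real n..real n + 1} f - L) < e" if "n \<ge> n0" for n
  proof -
    have int: "f integrable_on {real n..real n + 1}"
      using assms(1) by (meson continuous_on_subset integrable_continuous_real top_greatest)
    have "integral {real n..real n + 1} (\<lambda>x. f x - L) = integral {real n..real n + 1} f - L"
      using int by (subst integral_diff) auto
    moreover have "norm (integral {real n..real n + 1} (\<lambda>x. f x - L)) \<le> e/2 * (real n + 1 - real n)"
    proof (rule integral_bound)
      show "continuous_on {real n..real n + 1} (\<lambda>x. f x - L)"
        using assms(1) by (intro continuous_intros) (auto elim: continuous_on_subset)
      show "norm (f t - L) \<le> e/2" if "t \<in> {real n..real n + 1}" for t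
        using N[of t] that \<open>n \<ge> n0\<close> n0 by fastforce
    qed auto
    ultimately show ?thesis using \<open>e > 0\<close> by simp
  qed
  then show "\<exists>no. \<forall>n\<ge>no. norm (integral {real n..real n + 1} f - L) < e" by blast
qed

lemma continuous_on_uncurried_compose:
  fixes f :: "'a::topological_space \<Rightarrow> 'b::topological_space \<Rightarrow> 'c::topological_space"
  assumes "continuous_on (I \<times> UNIV) (\<lambda>(t, x). f t x)"
    and "continuous_on S g" "continuous_on S k" "\<And>p. p \<in> S \<Longrightarrow> g p \<in> I"
  shows "continuous_on S (\<lambda>p. f (g p) (k p))"
  using continuous_on_compose2[OF assms(1) continuous_on_Pair[OF assms(2,3)]] assms(4) by auto

lemma continuous_on_slice:
  fixes f :: "real \<Rightarrow> real \<Rightarrow> real"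
  assumes "continuous_on (I \<times> UNIV) (\<lambda>(t, x). f t x)" and "t \<in> I"
  shows "continuous_on S (f t)"
  using continuous_on_uncurried_compose[OF assms(1), of S "\<lambda>_. t" "\<lambda>x. x"] assms(2)
  by (auto simp: continuous_on_const continuous_on_id)

lemma integral_difference_eq_flux_difference:
  fixes h k J :: "real \<Rightarrow> real \<Rightarrow> real"
  assumes "s \<le> t" and "a \<le> b"
    and ht: "\<And>r x. r \<in> {s..t} \<Longrightarrow> ((\<lambda>r. h r x) has_vector_derivative k r x) (at r within {s..t})"
    and Jx: "\<And>r x. r \<in> {s..t} \<Longrightarrow> (J r has_vector_derivative k r x) (at x)"
    and k: "continuous_on ({s..t} \<times> UNIV) (\<lambda>(r, x). k r x)"
  shows "integral {a..b} (\<lambda>x. h t x - h s x) = integral {s..t} (\<lambda>r. J r b - J r a)"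
proof -
  have "integral {a..b} (\<lambda>x. h t x - h s x) = integral {a..b} (\<lambda>x. integral {s..t} (\<lambda>r. k r x))"
    using integral_unique[OF fundamental_theorem_of_calculus[OF \<open>s \<le> t\<close> ht]]
    by (intro integral_cong) auto
  also have "\<dots> = integral {s..t} (\<lambda>r. integral {a..b} (k r))"
    using integral_swap_continuous[of s a t b k] continuous_on_subset[OF k, of "cbox (s, a) (t, b)"]
    by (simp add: cbox_Pair_eq Sigma_mono)
  also have "\<dots> = integral {s..t} (\<lambda>r. J r b - J r a)"
  proof (intro integral_cong integral_unique)
    fix r assume "r \<in> {s..t}"
    then show "(k r has_integral J r b - J r a) {a..b}"
      using fundamental_theorem_of_calculus[OF \<open>a \<le> b\<close>, of "J r" "k r"] Jx
      by (meson has_vector_derivative_at_within)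
  qed
  finally show ?thesis .
qed

text \<open>
  The change of the integral over \<open>[- R, R]\<close> is the time integral of a flux that tends to zero at each
  time. Averaged over \<open>R\<close> in \<open>[n, n + 1]\<close> the flux is bounded uniformly in time, so dominated convergence
  applies; averaging does not affect the limit of the left-hand side.
\<close>

lemma conserved_if_averaged_flux_bounded:
  fixes h k J :: "real \<Rightarrow> real \<Rightarrow> real"
  assumes "s < t"
    and ht: "\<And>r x. r \<in> {s..t} \<Longrightarrow> ((\<lambda>r. h r x) has_vector_derivative k r x) (at r within {s..t})"
    and Jx: "\<And>r x. r \<in> {s..t} \<Longrightarrow> (J r has_vector_derivative k r x) (at x)"
    and k: "continuous_on ({s..t} \<times> UNIV) (\<lambda>(r, x). k r x)"
    and J: "continuous_on ({s..t} \<times> UNIV) (\<lambda>(r, x). J r x)"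
    and top: "\<And>r. r \<in> {s..t} \<Longrightarrow> (J r \<longlongrightarrow> 0) at_top"
    and bot: "\<And>r. r \<in> {s..t} \<Longrightarrow> (J r \<longlongrightarrow> 0) at_bot"
    and bound: "\<And>r a. r \<in> {s..t} \<Longrightarrow> \<bar>integral {a..a + 1} (J r)\<bar> \<le> C"
    and int: "integrable lborel (h s)" "integrable lborel (h t)"
  shows "(LINT x|lborel. h s x) = (LINT x|lborel. h t x)"
proof -
  \<comment> \<open>\<open>F r R\<close> is the net flux into \<open>{-R..R}\<close> at time \<open>r\<close>, and \<open>\<phi> R\<close> is the total inflow.\<close>
  define F where "F r x = J r x - J r (- x)" for r x
  define \<phi> where "\<phi> R = integral {s..t} (\<lambda>r. F r R)" for R
  have F: "continuous_on ({s..t} \<times> UNIV) (\<lambda>(r, x). F r x)"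
  proof -
    have "continuous_on ({s..t} \<times> UNIV) (\<lambda>(r, x). J r (- x))"
      unfolding case_prod_beta by (rule continuous_on_uncurried_compose[OF J]) (auto intro!: continuous_intros)
    then show ?thesis
      using J unfolding F_def case_prod_beta by (intro continuous_intros)
  qed
  have F_space: "continuous_on UNIV (F r)" if "r \<in> {s..t}" for r
    using continuous_on_slice[OF F that] .
  have swapped: "continuous_on (UNIV \<times> {s..t}) (\<lambda>(x, r). F r x)"
    unfolding case_prod_beta by (rule continuous_on_uncurried_compose[OF F]) (auto intro!: continuous_intros)
  have "continuous_on UNIV \<phi>"
    unfolding \<phi>_def using integral_continuous_on_param[of UNIV s t "\<lambda>x r. F r x"] swapped by simp
  moreover have "(\<phi> \<longlongrightarrow> (LINT x|lborel. h t x) - (LINT x|lborel. h s x)) at_top"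
  proof (rule Lim_transform_eventually)
    show "((\<lambda>R. integral {-R..R} (h t) - integral {-R..R} (h s)) \<longlongrightarrow>
            (LINT x|lborel. h t x) - (LINT x|lborel. h s x)) at_top"
      using int by (intro tendsto_diff tendsto_integral_symmetric_interval)
    have on: "h r integrable_on {-R..R}" if "integrable lborel (h r)" for r R
      using integrable_on_subinterval[of "h r" UNIV "-R" R] has_integral_integral_lborel[OF that]
      by (auto simp: integrable_on_def)
    show "\<forall>\<^sub>F R in at_top. integral {-R..R} (h t) - integral {-R..R} (h s) = \<phi> R"
      using eventually_ge_at_top[of 0]
    proof eventually_elim
      case (elim R)
      show ?case
        using integral_difference_eq_flux_difference[OF less_imp_le[OF \<open>s < t\<close>] _ ht Jx k, of "-R" R]
          elim int integral_diff[OF on on, of t s R] by (simp add: \<phi>_def F_def)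
    qed
  qed
  ultimately have "(\<lambda>n. integral {real n..real n + 1} \<phi>) \<longlonglongrightarrow>
      (LINT x|lborel. h t x) - (LINT x|lborel. h s x)"
    by (rule moving_average_tendsto)
  moreover have "(\<lambda>n. integral {real n..real n + 1} \<phi>) \<longlonglongrightarrow> integral {s..t} (\<lambda>_. 0)"
  proof -
    have swap: "integral {real n..real n + 1} \<phi> = integral {s..t} (\<lambda>r. integral {real n..real n + 1} (F r))" for n
      using integral_swap_continuous[of "real n" s "real n + 1" t "\<lambda>x r. F r x"]
        continuous_on_subset[OF swapped, of "cbox (real n, s) (real n + 1, t)"]
      by (simp add: cbox_Pair_eq Sigma_mono \<phi>_def[abs_def])
    have avg_cont: "continuous_on {s..t} (\<lambda>r. integral {real n..real n + 1} (F r))" for n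
      using integral_continuous_on_param[of "{s..t}" "real n" "real n + 1" F]
        continuous_on_subset[OF F, of "{s..t} \<times> cbox (real n) (real n + 1)"]
      by (simp add: Sigma_mono)
    show ?thesis
      unfolding swap
    proof (rule dominated_convergence(2)[where h = "\<lambda>_. 2 * C"])
      show "(\<lambda>r. integral {real n..real n + 1} (F r)) integrable_on {s..t}" for n
        using avg_cont by (rule integrable_continuous_real)
      show "norm (integral {real n..real n + 1} (F r)) \<le> 2 * C" if r: "r \<in> {s..t}" for n r
      proof -
        have J_on: "J r integrable_on {a..b}" for a b
          using continuous_on_slice[OF J r] by (rule integrable_continuous_real)
        have refl: "(\<lambda>x. J r (- x)) integrable_on {real n..real n + 1}"
          by (intro integrable_continuous_real continuous_on_uncurried_compose[OF J])
            (use r in \<open>auto intro!: continuous_intros\<close>)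
        have "integral {real n..real n + 1} (F r)
            = integral {real n..real n + 1} (J r) - integral {real n..real n + 1} (\<lambda>x. J r (- x))"
          unfolding F_def using J_on refl by (rule integral_diff)
        also have "integral {real n..real n + 1} (\<lambda>x. J r (- x)) = integral {- real n - 1..- real n - 1 + 1} (J r)"
          using Henstock_Kurzweil_Integration.integral_reflect_real[of "- real n" "- real n - 1" "J r"]
          by (simp add: add.commute)
        finally show ?thesis
          using bound[OF r, of "real n"] bound[OF r, of "- real n - 1"] by simp
      qed
      show "(\<lambda>n. integral {real n..real n + 1} (F r)) \<longlonglongrightarrow> 0" if r: "r \<in> {s..t}" for r
      proof (rule moving_average_tendsto[OF F_space[OF r]])
        have "((\<lambda>x. J r (- x)) \<longlongrightarrow> 0) at_top"
          using bot[OF r] by (simp add: filterlim_at_bot_mirror)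
        then show "(F r \<longlongrightarrow> 0) at_top"
          using tendsto_diff[OF top[OF r]] by (fastforce simp: F_def[abs_def])
      qed
    qed auto
  qed
  ultimately show ?thesis
    using LIMSEQ_unique by fastforce
qed

section \<open>Bounds for decaying functions on the line\<close>

text \<open>
  Integrate \<open>(v\<^sup>2)' = 2 v v' \<le> v\<^sup>2 + v'\<^sup>2\<close> from \<open>- \<infinity>\<close>.
\<close>

lemma square_le_energy:
  fixes v v' :: "real \<Rightarrow> real"
  assumes v: "\<And>x. (v has_vector_derivative v' x) (at x)"
    and v'_cont: "continuous_on UNIV v'"
    and bot: "(v \<longlongrightarrow> 0) at_bot"
    and int: "integrable lborel (\<lambda>x. (v x)\<^sup>2 + (v' x)\<^sup>2)"
  shows "(v x)\<^sup>2 \<le> (LINT y|lborel. (v y)\<^sup>2 + (v' y)\<^sup>2)" (is "_ \<le> ?E")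
proof -
  have v_cont: "continuous_on UNIV v"
    using v by (meson continuous_at_imp_continuous_on has_vector_derivative_continuous)
  have le: "(v x)\<^sup>2 - (v a)\<^sup>2 \<le> ?E" if "a \<le> x" for a
  proof -
    have "((\<lambda>y. 2 * v y * v' y) has_integral (v x)\<^sup>2 - (v a)\<^sup>2) {a..x}"
    proof (rule fundamental_theorem_of_calculus[OF that])
      fix y
      have "((\<lambda>y. (v y)\<^sup>2) has_real_derivative 2 * v y * v' y) (at y)"
        using v[of y] unfolding has_real_derivative_iff_has_vector_derivative[symmetric]
        by (auto intro!: derivative_eq_intros)
      then show "((\<lambda>y. (v y)\<^sup>2) has_vector_derivative 2 * v y * v' y) (at y within {a..x})"
        by (simp add: has_real_derivative_iff_has_vector_derivative has_vector_derivative_at_within)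
    qed
    moreover have "((\<lambda>y. (v y)\<^sup>2 + (v' y)\<^sup>2) has_integral integral {a..x} (\<lambda>y. (v y)\<^sup>2 + (v' y)\<^sup>2)) {a..x}"
      by (intro integrable_integral integrable_continuous_real continuous_intros)
        (use v_cont v'_cont in \<open>auto elim: continuous_on_subset\<close>)
    ultimately have "(v x)\<^sup>2 - (v a)\<^sup>2 \<le> integral {a..x} (\<lambda>y. (v y)\<^sup>2 + (v' y)\<^sup>2)"
      by (rule has_integral_le) (rule sum_squares_bound)
    also have "\<dots> \<le> ?E" using int by (rule integral_Icc_le_LINT) simp
    finally show ?thesis .
  qed
  have "((\<lambda>a. (v x)\<^sup>2 - (v a)\<^sup>2) \<longlongrightarrow> (v x)\<^sup>2 - 0\<^sup>2) at_bot"
    by (intro tendsto_intros bot)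
  moreover have "\<forall>\<^sub>F a in at_bot. (v x)\<^sup>2 - (v a)\<^sup>2 \<le> ?E"
    using eventually_le_at_bot[of x] by eventually_elim (rule le)
  ultimately show ?thesis
    using tendsto_upperbound[of "\<lambda>a. (v x)\<^sup>2 - (v a)\<^sup>2" "(v x)\<^sup>2 - 0\<^sup>2" at_bot ?E] by simp
qed

text \<open>
  The decaying solution of \<open>k' = k - f\<close> is \<open>k x = \<integral> exp (x - y) f y dy\<close> over \<open>y \<ge> x\<close>, where the kernel is
  at most one.
\<close>

lemma first_order_decaying_bound:
  fixes k f q :: "real \<Rightarrow> real"
  assumes k: "\<And>x. (k has_vector_derivative k x - f x) (at x)"
    and top: "(k \<longlongrightarrow> 0) at_top"
    and fq: "\<And>x. \<bar>f x\<bar> \<le> q x" and q_cont: "continuous_on UNIV q"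
    and q: "\<And>a b. integral {a..b} q \<le> B"
  shows "\<bar>k x\<bar> \<le> B"
proof -
  have step: "\<bar>k x\<bar> \<le> B + \<bar>k b\<bar>" if "x \<le> b" for b
  proof -
    \<comment> \<open>Variation of constants on \<open>{x..b}\<close>; the boundary term at \<open>b\<close> disappears in the limit.\<close>
    have deriv: "((\<lambda>y. - exp (- y) * f y) has_integral exp (- b) * k b - exp (- x) * k x) {x..b}"
    proof (rule fundamental_theorem_of_calculus[OF that])
      fix y
      have "((\<lambda>y. exp (- y) * k y) has_real_derivative - exp (- y) * f y) (at y)"
        using k[of y] unfolding has_real_derivative_iff_has_vector_derivative[symmetric]
        by (auto intro!: derivative_eq_intros simp: algebra_simps)
      then show "((\<lambda>y. exp (- y) * k y) has_vector_derivative - exp (- y) * f y) (at y within {x..b})"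
        by (simp add: has_real_derivative_iff_has_vector_derivative has_vector_derivative_at_within)
    qed
    have q_on: "q integrable_on {x..b}"
      using q_cont by (meson continuous_on_subset integrable_continuous_real top_greatest)
    have "norm (integral {x..b} (\<lambda>y. - exp (- y) * f y)) \<le> integral {x..b} (\<lambda>y. exp (- x) * q y)"
    proof (rule integral_norm_bound_integral)
      show "(\<lambda>y. - exp (- y) * f y) integrable_on {x..b}" using deriv by blast
      show "(\<lambda>y. exp (- x) * q y) integrable_on {x..b}" using integrable_on_cmult_left[OF q_on, of "exp (- x)"] by simp
      show "norm (- exp (- y) * f y) \<le> exp (- x) * q y" if "y \<in> {x..b}" for y
        using fq[of y] that by (auto simp: abs_mult intro!: mult_mono)
    qed
    also have "\<dots> \<le> exp (- x) * B" using q[of x b] by simp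
    finally have "\<bar>exp (- b) * k b - exp (- x) * k x\<bar> \<le> exp (- x) * B"
      using integral_unique[OF deriv] by simp
    moreover have "\<bar>exp (- b) * k b\<bar> \<le> exp (- x) * \<bar>k b\<bar>"
      using that by (simp add: abs_mult mult_right_mono)
    moreover have "\<bar>exp (- x) * k x\<bar> = exp (- x) * \<bar>k x\<bar>" by (simp add: abs_mult)
    ultimately have "exp (- x) * \<bar>k x\<bar> \<le> exp (- x) * (B + \<bar>k b\<bar>)"
      by (simp add: distrib_left)
    then show ?thesis by simp
  qed
  have "((\<lambda>b. B + \<bar>k b\<bar>) \<longlongrightarrow> B + \<bar>0\<bar>) at_top"
    by (intro tendsto_intros top)
  moreover have "\<forall>\<^sub>F b in at_top. \<bar>k x\<bar> \<le> B + \<bar>k b\<bar>"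
    using eventually_ge_at_top[of x] by eventually_elim (rule step)
  ultimately show ?thesis
    using tendsto_lowerbound[of "\<lambda>b. B + \<bar>k b\<bar>" "B + \<bar>0\<bar>" at_top "\<bar>k x\<bar>"] by simp
qed

text \<open>
  If \<open>w - w'' = f\<close> then \<open>k = w + w'\<close> satisfies \<open>k' = k - f\<close>, and \<open>w - w'\<close> satisfies the same equation
  after the reflection \<open>x \<mapsto> - x\<close>. Half the sum and half the difference of the two bounds give the claim. This
  replaces the representation of \<open>w\<close> as the convolution of \<open>f\<close> with \<open>exp (- \<bar>x\<bar>) / 2\<close>.
\<close>

lemma resolvent_bound:
  fixes w w' f q :: "real \<Rightarrow> real"
  assumes w: "\<And>x. (w has_vector_derivative w' x) (at x)"
    and w': "\<And>x. (w' has_vector_derivative w x - f x) (at x)"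
    and lim: "(w \<longlongrightarrow> 0) at_top" "(w \<longlongrightarrow> 0) at_bot" "(w' \<longlongrightarrow> 0) at_top" "(w' \<longlongrightarrow> 0) at_bot"
    and fq: "\<And>x. \<bar>f x\<bar> \<le> q x" and q_cont: "continuous_on UNIV q"
    and q: "\<And>a b. integral {a..b} q \<le> B"
  shows "\<bar>w x\<bar> \<le> B" and "\<bar>w' x\<bar> \<le> B"
proof -
  have plus: "\<bar>w x + w' x\<bar> \<le> B"
  proof (rule first_order_decaying_bound[where k = "\<lambda>x. w x + w' x", OF _ _ fq q_cont q])
    show "((\<lambda>x. w x + w' x) has_vector_derivative w x + w' x - f x) (at x)" for x
      using has_vector_derivative_add[OF w w', of x] by (simp add: algebra_simps)
    show "((\<lambda>x. w x + w' x) \<longlongrightarrow> 0) at_top" using tendsto_add[OF lim(1,3)] by simp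
  qed
  have minus: "\<bar>w (- y) - w' (- y)\<bar> \<le> B" for y
  proof (rule first_order_decaying_bound[where k = "\<lambda>y. w (- y) - w' (- y)" and f = "\<lambda>y. f (- y)" and q = "\<lambda>y. q (- y)"])
    show "((\<lambda>y. w (- y) - w' (- y)) has_vector_derivative w (- y) - w' (- y) - f (- y)) (at y)" for y
    proof -
      have "((\<lambda>y. w (- y)) has_real_derivative w' (- y) * (- 1)) (at y)"
        using w[of "- y"] unfolding has_real_derivative_iff_has_vector_derivative[symmetric]
        by (rule DERIV_chain2) (auto intro!: derivative_eq_intros)
      moreover have "((\<lambda>y. w' (- y)) has_real_derivative (w (- y) - f (- y)) * (- 1)) (at y)"
        using w'[of "- y"] unfolding has_real_derivative_iff_has_vector_derivative[symmetric]
        by (rule DERIV_chain2) (auto intro!: derivative_eq_intros)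
      ultimately show ?thesis
        unfolding has_real_derivative_iff_has_vector_derivative[symmetric]
        by (auto intro!: derivative_eq_intros)
    qed
    show "((\<lambda>y. w (- y) - w' (- y)) \<longlongrightarrow> 0) at_top"
      using tendsto_diff[OF lim(2,4)] by (simp add: filterlim_at_bot_mirror)
    show "continuous_on UNIV (\<lambda>y. q (- y))"
      by (rule continuous_on_compose2[OF q_cont]) (auto intro!: continuous_intros)
    show "integral {a..b} (\<lambda>y. q (- y)) \<le> B" for a b
      using Henstock_Kurzweil_Integration.integral_reflect_real[of "- a" "- b" q] q[of "- b" "- a"] by simp
  qed (rule fq)
  show "\<bar>w x\<bar> \<le> B" "\<bar>w' x\<bar> \<le> B"
    using plus minus[of "- x"] by auto
qed

text \<open>
  A flux that is dominated pointwise by an integrable density need not be bounded, but its integrals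
  over unit intervals are.
\<close>

lemma averaged_flux_bound:
  fixes J e :: "real \<Rightarrow> real"
  assumes "continuous_on UNIV J" and e: "integrable lborel e" "\<And>x. 0 \<le> e x"
    and J: "\<And>x. \<bar>J x\<bar> \<le> C + D * e x" and "0 \<le> D" and "(LINT x|lborel. e x) \<le> M"
  shows "\<bar>integral {a..a + 1} J\<bar> \<le> C + D * M"
proof -
  have e_on: "e integrable_on {a..a + 1}"
    using integrable_on_subinterval[of e UNIV a "a + 1"] has_integral_integral_lborel[OF e(1)]
    by (auto simp: integrable_on_def)
  have De_on: "(\<lambda>x. D * e x) integrable_on {a..a + 1}"
    using integrable_on_cmult_left[OF e_on, of D] by simp
  have "norm (integral {a..a + 1} J) \<le> integral {a..a + 1} (\<lambda>x. C + D * e x)"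
  proof (rule integral_norm_bound_integral)
    show "J integrable_on {a..a + 1}"
      using assms(1) by (meson continuous_on_subset integrable_continuous_real top_greatest)
    show "(\<lambda>x. C + D * e x) integrable_on {a..a + 1}"
      using De_on by (intro integrable_add) auto
  qed (use J in auto)
  also have "\<dots> = C + D * integral {a..a + 1} e"
    using De_on by (subst integral_add) auto
  also have "\<dots> \<le> C + D * M"
    using integral_Icc_le_LINT[OF e, of a "a + 1"] assms by (intro add_left_mono mult_left_mono) auto
  finally show ?thesis by simp
qed

section \<open>Derivatives of functions of class C k\<close>

lemma C_on_continuous: "C_on n I v \<Longrightarrow> continuous_on (I \<times> UNIV) (\<lambda>(t, x). v t x)"
  by (cases n) auto

lemma C_on_Suc_has_derivatives:
  assumes "C_on (Suc n) I v" and "t \<in> I"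
  shows "(v t has_real_derivative pd_x v t x) (at x)"
    and "((\<lambda>s. v s x) has_real_derivative pd_t I v t x) (at t within I)"
proof -
  have "v t differentiable (at x)" and "(\<lambda>s. v s x) differentiable (at t within I)"
    using assms by auto
  then show "(v t has_real_derivative pd_x v t x) (at x)"
    and "((\<lambda>s. v s x) has_real_derivative pd_t I v t x) (at t within I)"
    by (simp_all add: pd_x_def DERIV_deriv_iff_real_differentiable pd_t_def
        has_real_derivative_iff_has_vector_derivative[of "\<lambda>s. v s x"] vector_derivative_works)
qed

text \<open>
  Differentiate \<open>v r x - v p x = \<integral> v_t\<close> in \<open>x\<close> under the integral sign over \<open>[p, r]\<close>, and then in \<open>r\<close>. The
  interval \<open>[p, q]\<close> must be nondegenerate, as the derivative within a single point is arbitrary.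
\<close>

lemma mixed_partials_commute:
  assumes v: "C_on (Suc (Suc n)) I v" and "p < q" and sub: "{p..q} \<subseteq> I" and t: "t \<in> {p..q}"
  shows "pd_t I (pd_x v) t x = pd_x (pd_t I v) t x"
proof -
  have vt: "C_on (Suc n) I (pd_t I v)" and vx: "C_on (Suc n) I (pd_x v)" and vtx: "C_on n I (pd_x (pd_t I v))"
    using v by auto
  have time_slice: "continuous_on {p..r} (\<lambda>\<sigma>. f \<sigma> y)"
    if "continuous_on (I \<times> UNIV) (\<lambda>(t, x). f t x)" "r \<in> {p..q}" for f :: "real \<Rightarrow> real \<Rightarrow> real" and r y
    by (rule continuous_on_uncurried_compose[OF that(1)]) (use sub that in \<open>auto intro!: continuous_intros\<close>)
  have eq: "pd_x v r x - pd_x v p x = integral {p..r} (\<lambda>\<sigma>. pd_x (pd_t I v) \<sigma> x)" if r: "r \<in> {p..q}" for r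
  proof -
    have sub': "{p..r} \<subseteq> I" and "p \<in> I" "r \<in> I" using sub r by auto
    have "integral {p..r} (\<lambda>\<sigma>. pd_t I v \<sigma> y) = v r y - v p y" for y
    proof (rule integral_unique, rule fundamental_theorem_of_calculus)
      fix \<sigma> assume "\<sigma> \<in> {p..r}"
      then have "\<sigma> \<in> I" using sub' by blast
      show "((\<lambda>\<sigma>. v \<sigma> y) has_vector_derivative pd_t I v \<sigma> y) (at \<sigma> within {p..r})"
        using DERIV_subset[OF C_on_Suc_has_derivatives(2)[OF v \<open>\<sigma> \<in> I\<close>] sub']
        by (simp add: has_real_derivative_iff_has_vector_derivative)
    qed (use r in auto)
    moreover have "((\<lambda>y. integral {p..r} (\<lambda>\<sigma>. pd_t I v \<sigma> y)) has_real_derivative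
        integral {p..r} (\<lambda>\<sigma>. pd_x (pd_t I v) \<sigma> x)) (at x)"
    proof (rule leibniz_rule_field_derivative[of UNIV p r "\<lambda>y \<sigma>. pd_t I v \<sigma> y", simplified])
      show "((\<lambda>y. pd_t I v \<sigma> y) has_real_derivative pd_x (pd_t I v) \<sigma> y) (at y)" if "p \<le> \<sigma> \<and> \<sigma> \<le> r" for y \<sigma>
        using C_on_Suc_has_derivatives(1)[OF vt, of \<sigma> y] sub' that by auto
      show "(\<lambda>\<sigma>. pd_t I v \<sigma> y) integrable_on {p..r}" for y
        by (rule integrable_continuous_real[OF time_slice[OF C_on_continuous[OF vt] r]])
      show "continuous_on (UNIV \<times> {p..r}) (\<lambda>(y, \<sigma>). pd_x (pd_t I v) \<sigma> y)"
        unfolding case_prod_beta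
        by (rule continuous_on_uncurried_compose[OF C_on_continuous[OF vtx]])
          (use sub' in \<open>auto intro!: continuous_intros\<close>)
    qed
    ultimately have "((\<lambda>y. v r y - v p y) has_real_derivative
        integral {p..r} (\<lambda>\<sigma>. pd_x (pd_t I v) \<sigma> x)) (at x)" by simp
    moreover have "((\<lambda>y. v r y - v p y) has_real_derivative pd_x v r x - pd_x v p x) (at x)"
      using C_on_Suc_has_derivatives(1)[OF v \<open>r \<in> I\<close>] C_on_Suc_has_derivatives(1)[OF v \<open>p \<in> I\<close>]
      by (rule DERIV_diff)
    ultimately show ?thesis by (rule DERIV_unique[symmetric])
  qed
  have "q \<in> {p..q}" using \<open>p < q\<close> by simp
  have "((\<lambda>r. pd_x v p x + integral {p..r} (\<lambda>\<sigma>. pd_x (pd_t I v) \<sigma> x)) has_vector_derivative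
      0 + pd_x (pd_t I v) t x) (at t within {p..q})"
    by (intro has_vector_derivative_add has_vector_derivative_const integral_has_vector_derivative
        time_slice C_on_continuous[OF vtx] t \<open>q \<in> {p..q}\<close>)
  then have "((\<lambda>r. pd_x v r x) has_vector_derivative 0 + pd_x (pd_t I v) t x) (at t within {p..q})"
    by (rule has_vector_derivative_transform[OF t, rotated]) (simp add: eq[symmetric])
  moreover have "((\<lambda>r. pd_x v r x) has_vector_derivative pd_t I (pd_x v) t x) (at t within {p..q})"
    using DERIV_subset[OF C_on_Suc_has_derivatives(2)[OF vx subsetD[OF sub t]] sub]
    by (simp add: has_real_derivative_iff_has_vector_derivative)
  ultimately show ?thesis
    using vector_derivative_unique_within_closed_interval[OF \<open>p < q\<close>, of t] t by (simp add: cbox_interval) blast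
qed

section \<open>Solutions with vanishing jets and finite energy\<close>

text \<open>
  A nondegenerate time interval makes the derivative in time within \<open>I\<close> unique, on which the symmetry of
  the mixed derivatives of \<open>u\<close> rests.
\<close>

locale decaying_solution =
  fixes u :: "real \<Rightarrow> real \<Rightarrow> real" and I :: "real set"
  assumes interval: "is_interval I" and nontrivial: "\<exists>a\<in>I. \<exists>b\<in>I. a < b"
    and smooth: "C_on 3 I u"
    and solution: "solves_equation I u"
    and decay: "vanishes_at_infinity_upto 2 I u"
    and finite_energy: "\<And>t. t \<in> I \<Longrightarrow> integrable lborel (\<lambda>x. (u t x)\<^sup>2 + (deriv (u t) x)\<^sup>2)"
begin

abbreviation "ut \<equiv> pd_t I u"
abbreviation "ux \<equiv> pd_x u"
abbreviation "uxx \<equiv> pd_x ux"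
abbreviation "uxxx \<equiv> pd_x uxx"
abbreviation "utx \<equiv> pd_x ut"
abbreviation "utxx \<equiv> pd_x utx"

abbreviation "energy_density t x \<equiv> (u t x)\<^sup>2 + (ux t x)\<^sup>2"

definition "energy t = (LINT x|lborel. energy_density t x)"

lemma energy_integrable: "t \<in> I \<Longrightarrow> integrable lborel (energy_density t)"
  using finite_energy by (simp add: pd_x_def)

lemma regular: "C_on (Suc (Suc (Suc 0))) I u" "C_on (Suc (Suc 0)) I ut" "C_on (Suc (Suc 0)) I ux"
  "C_on (Suc 0) I utx" "C_on (Suc 0) I uxx"
  using smooth by (simp_all add: numeral_3_eq_3)

lemmas space_derivs = regular[THEN C_on_Suc_has_derivatives(1)]

lemmas jointly_continuous = regular[THEN C_on_continuous]

lemma subinterval: "a \<in> I \<Longrightarrow> b \<in> I \<Longrightarrow> {a..b} \<subseteq> I"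
  using interval unfolding is_interval_1 by (meson atLeastAtMost_iff subsetI)

lemma uxt_eq_utx:
  assumes "t \<in> I"
  shows "pd_t I ux t x = utx t x"
proof -
  obtain a b where "a \<in> I" "b \<in> I" "a < b" using nontrivial by blast
  have "min a t \<in> I" "max b t \<in> I"
    using \<open>a \<in> I\<close> \<open>b \<in> I\<close> assms unfolding min_def max_def by presburger+
  then have sub: "{min a t..max b t} \<subseteq> I" by (rule subinterval)
  show ?thesis
    by (rule mixed_partials_commute[OF regular(1) _ sub]) (use \<open>a < b\<close> in auto)
qed

lemma time_derivs:
  assumes "t \<in> I"
  shows "((\<lambda>s. u s x) has_real_derivative ut t x) (at t within I)"
    and "((\<lambda>s. ux s x) has_real_derivative utx t x) (at t within I)"
  using C_on_Suc_has_derivatives(2)[OF regular(1) assms] C_on_Suc_has_derivatives(2)[OF regular(3) assms]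
  by (simp_all add: uxt_eq_utx[OF assms])

lemma jets_vanish:
  assumes "t \<in> I" and F: "F = at_top \<or> F = at_bot"
  shows "(u t \<longlongrightarrow> 0) F" "(ux t \<longlongrightarrow> 0) F" "(uxx t \<longlongrightarrow> 0) F" "(ut t \<longlongrightarrow> 0) F" "(utx t \<longlongrightarrow> 0) F"
proof -
  have *: "((pd_t I ^^ i) ((pd_x ^^ j) u) t \<longlongrightarrow> 0) F" if "i + j \<le> 2" for i j
    using decay[unfolded vanishes_at_infinity_upto_def, rule_format, OF that assms(1)] F by (elim disjE) simp_all
  have "pd_t I ux t = utx t" by (rule ext) (rule uxt_eq_utx[OF assms(1)])
  then show "(u t \<longlongrightarrow> 0) F" "(ux t \<longlongrightarrow> 0) F" "(uxx t \<longlongrightarrow> 0) F" "(ut t \<longlongrightarrow> 0) F" "(utx t \<longlongrightarrow> 0) F"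
    using *[of 0 0] *[of 0 1] *[of 0 2] *[of 1 0] *[of 1 1] by (simp_all add: numeral_2_eq_2)
qed

text \<open>
  On smooth decaying solutions \<open>w\<close> is the nonlocal term \<open>(1 - \<partial>\<^sup>2)\<^sup>-\<^sup>1 (u\<^sup>2 / 2 - u_x\<^sup>2 / 2 - u\<^sup>3)\<close>, written with
  local derivatives of \<open>u\<close>, and \<open>wx\<close> is its space derivative.
\<close>

definition "w t x = u t x * uxx t x + (ux t x)\<^sup>2 / 2 - (u t x)^3 + utx t x + (u t x)\<^sup>2 / 2"

definition "wx t x = ut t x + u t x * ux t x"

text \<open>
  This is the equation itself: the right-hand side \<open>u u_xxx + 2 u_x u_xx - 3 u\<^sup>2 u_x\<close> is the space derivative of
  \<open>u u_xx + u_x\<^sup>2 / 2 - u\<^sup>3\<close>.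
\<close>

lemma w_deriv:
  assumes "t \<in> I"
  shows "(w t has_real_derivative wx t x) (at x)"
proof -
  have "ut t x - utxx t x + 3 * (u t x)\<^sup>2 * ux t x = u t x * uxxx t x + 2 * ux t x * uxx t x"
    using solution assms unfolding solves_equation_def by blast
  then have eq: "ut t x + u t x * ux t x = u t x * uxxx t x + 2 * ux t x * uxx t x - 3 * (u t x)\<^sup>2 * ux t x
      + utxx t x + u t x * ux t x" by linarith
  show ?thesis
    unfolding w_def[abs_def] wx_def eq
    by (rule derivative_eq_intros refl numeral_neq_zero space_derivs[OF assms])+ (simp add: algebra_simps power2_eq_square)
qed

lemma wx_deriv:
  assumes "t \<in> I"
  shows "(wx t has_real_derivative w t x - ((u t x)\<^sup>2 / 2 - (ux t x)\<^sup>2 / 2 - (u t x)^3)) (at x)"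
  unfolding w_def wx_def[abs_def]
  by (rule derivative_eq_intros refl numeral_neq_zero space_derivs[OF assms])+ (simp add: algebra_simps power2_eq_square)

lemma w_vanishes:
  assumes "t \<in> I" and F: "F = at_top \<or> F = at_bot"
  shows "(w t \<longlongrightarrow> 0) F" "(wx t \<longlongrightarrow> 0) F"
proof -
  have "(w t \<longlongrightarrow> 0 * 0 + 0\<^sup>2 / 2 - 0^3 + 0 + 0\<^sup>2 / 2) F" "(wx t \<longlongrightarrow> 0 + 0 * 0) F"
    unfolding w_def[abs_def] wx_def[abs_def]
    by (intro tendsto_intros jets_vanish[OF assms]; simp)+
  then show "(w t \<longlongrightarrow> 0) F" "(wx t \<longlongrightarrow> 0) F" by simp_all
qed

lemma uncurried_continuous:
  "continuous_on (I \<times> UNIV) (\<lambda>p. u (fst p) (snd p))"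
  "continuous_on (I \<times> UNIV) (\<lambda>p. ut (fst p) (snd p))"
  "continuous_on (I \<times> UNIV) (\<lambda>p. ux (fst p) (snd p))"
  "continuous_on (I \<times> UNIV) (\<lambda>p. utx (fst p) (snd p))"
  "continuous_on (I \<times> UNIV) (\<lambda>p. uxx (fst p) (snd p))"
  using jointly_continuous by (simp_all add: case_prod_beta)

lemma w_continuous:
  "continuous_on (I \<times> UNIV) (\<lambda>p. w (fst p) (snd p))"
  "continuous_on (I \<times> UNIV) (\<lambda>p. wx (fst p) (snd p))"
  unfolding w_def wx_def by (intro continuous_intros uncurried_continuous; simp)+

lemma energy_density_continuous:
  assumes "t \<in> I"
  shows "continuous_on UNIV (energy_density t)"
  by (intro continuous_intros continuous_on_slice[OF jointly_continuous(1)]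
      continuous_on_slice[OF jointly_continuous(3)] assms)

text \<open>
  The assumption \<open>1 \<le> M\<close> only serves to keep the bounds polynomial: \<open>u\<^sup>2 \<le> M\<close> gives \<open>\<bar>u\<bar> \<le> M\<close>, and \<open>M \<le> M\<^sup>2\<close>.
  The source of the equation for \<open>w\<close> is dominated by \<open>q = (1/2 + M) (u\<^sup>2 + u_x\<^sup>2)\<close>, whose integral is at most
  \<open>(1/2 + M) M \<le> 2 M\<^sup>2\<close>.
\<close>

lemma pointwise_bounds:
  assumes t: "t \<in> I" and "energy t \<le> M" and "1 \<le> M"
  shows "\<bar>u t x\<bar> \<le> M" and "\<bar>w t x\<bar> \<le> 2 * M\<^sup>2" and "\<bar>wx t x\<bar> \<le> 2 * M\<^sup>2"
proof -
  have "M \<le> M\<^sup>2" using \<open>1 \<le> M\<close> by (simp add: power2_eq_square)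
  have u: "\<bar>u t y\<bar> \<le> M" for y
  proof -
    have "(u t y)\<^sup>2 \<le> energy t"
      unfolding energy_def
    proof (rule square_le_energy)
      show "(u t has_vector_derivative ux t x) (at x)" for x
        using space_derivs(1)[OF t] by (simp add: has_real_derivative_iff_has_vector_derivative)
      show "continuous_on UNIV (ux t)" using t by (rule continuous_on_slice[OF jointly_continuous(3)])
      show "(u t \<longlongrightarrow> 0) at_bot" using jets_vanish(1)[OF t] by blast
    qed (rule energy_integrable[OF t])
    then have "(u t y)\<^sup>2 \<le> M\<^sup>2" using \<open>energy t \<le> M\<close> \<open>M \<le> M\<^sup>2\<close> by linarith
    then show ?thesis using \<open>1 \<le> M\<close> abs_le_square_iff[of "u t y" M] by simp
  qed
  define q where "q y = (1/2 + M) * energy_density t y" for y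
  have fq: "\<bar>(u t y)\<^sup>2 / 2 - (ux t y)\<^sup>2 / 2 - (u t y)^3\<bar> \<le> q y" for y
  proof -
    have "\<bar>(u t y)^3\<bar> = \<bar>u t y\<bar> * (u t y)\<^sup>2"
      by (simp add: power3_eq_cube power2_eq_square abs_mult)
    also have "\<dots> \<le> M * (u t y)\<^sup>2" using u by (intro mult_right_mono) auto
    also have "\<dots> \<le> M * energy_density t y" using \<open>1 \<le> M\<close> by (intro mult_left_mono) auto
    finally have "\<bar>(u t y)^3\<bar> \<le> M * energy_density t y" .
    moreover have "q y = (u t y)\<^sup>2 / 2 + (ux t y)\<^sup>2 / 2 + M * energy_density t y"
      unfolding q_def by (simp add: field_simps)
    moreover have "0 \<le> (u t y)\<^sup>2" "0 \<le> (ux t y)\<^sup>2" by auto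
    ultimately show ?thesis by linarith
  qed
  have q_cont: "continuous_on UNIV q"
    unfolding q_def by (intro continuous_intros energy_density_continuous t)
  have q_int: "integral {a..b} q \<le> 2 * M\<^sup>2" for a b
  proof -
    have "integral {a..b} q = (1/2 + M) * integral {a..b} (energy_density t)"
      unfolding q_def by simp
    also have "\<dots> \<le> (1/2 + M) * M"
      using integral_Icc_le_LINT[OF energy_integrable[OF t], of a b] assms
      by (intro mult_left_mono) (auto simp: energy_def)
    also have "\<dots> \<le> 2 * M\<^sup>2" using \<open>M \<le> M\<^sup>2\<close> \<open>1 \<le> M\<close> by (simp add: algebra_simps power2_eq_square)
    finally show ?thesis .
  qed
  note bound = resolvent_bound[OF
      w_deriv[OF t, unfolded has_real_derivative_iff_has_vector_derivative]
      wx_deriv[OF t, unfolded has_real_derivative_iff_has_vector_derivative]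
      w_vanishes(1)[OF t disjI1[OF refl]] w_vanishes(1)[OF t disjI2[OF refl]]
      w_vanishes(2)[OF t disjI1[OF refl]] w_vanishes(2)[OF t disjI2[OF refl]] fq q_cont q_int]
  show "\<bar>u t x\<bar> \<le> M" "\<bar>w t x\<bar> \<le> 2 * M\<^sup>2" "\<bar>wx t x\<bar> \<le> 2 * M\<^sup>2"
    by (rule u bound)+
qed

text \<open>
  The domination of \<open>J\<close> by the energy density accommodates the terms with \<open>u_x\<^sup>2\<close> in the fluxes.
\<close>

lemma conserved_while_energy_bounded:
  assumes "s \<in> I" "t \<in> I" "s < t" and M: "\<And>r. r \<in> {s..t} \<Longrightarrow> energy r \<le> M"
    and ht: "\<And>r x. r \<in> I \<Longrightarrow> ((\<lambda>r. h r x) has_real_derivative k r x) (at r within I)"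
    and Jx: "\<And>r x. r \<in> I \<Longrightarrow> (J r has_real_derivative k r x) (at x)"
    and k: "continuous_on (I \<times> UNIV) (\<lambda>p. k (fst p) (snd p))"
    and J: "continuous_on (I \<times> UNIV) (\<lambda>p. J (fst p) (snd p))"
    and vanish: "\<And>r F. r \<in> I \<Longrightarrow> F = at_top \<or> F = at_bot \<Longrightarrow> (J r \<longlongrightarrow> 0) F"
    and bound: "\<And>r x. r \<in> {s..t} \<Longrightarrow> \<bar>J r x\<bar> \<le> C + D * energy_density r x" and "0 \<le> D"
    and int: "integrable lborel (h s)" "integrable lborel (h t)"
  shows "(LINT x|lborel. h s x) = (LINT x|lborel. h t x)"
proof -
  have sub: "{s..t} \<subseteq> I" using subinterval assms by blast
  have J': "continuous_on (I \<times> UNIV) (\<lambda>(r, x). J r x)" using J by (simp add: case_prod_beta)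
  have on: "continuous_on ({s..t} \<times> UNIV) g" if "continuous_on (I \<times> UNIV) g" for g :: "real \<times> real \<Rightarrow> real"
    using that sub by (auto elim!: continuous_on_subset)
  show ?thesis
  proof (rule conserved_if_averaged_flux_bounded[OF \<open>s < t\<close> _ _ _ _ _ _ _ int, where C = "C + D * M" and J = J and k = k])
    fix r x assume r: "r \<in> {s..t}"
    then have "r \<in> I" using sub by blast
    show "((\<lambda>r. h r x) has_vector_derivative k r x) (at r within {s..t})"
      using DERIV_subset[OF ht[OF \<open>r \<in> I\<close>] sub]
      by (simp add: has_real_derivative_iff_has_vector_derivative)
    show "(J r has_vector_derivative k r x) (at x)"
      using Jx[OF \<open>r \<in> I\<close>] by (simp add: has_real_derivative_iff_has_vector_derivative)
    show "(J r \<longlongrightarrow> 0) at_top" "(J r \<longlongrightarrow> 0) at_bot"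
      using vanish[OF \<open>r \<in> I\<close>] by auto
    show "\<bar>integral {a..a + 1} (J r)\<bar> \<le> C + D * M" for a
      using averaged_flux_bound[OF continuous_on_slice[OF J' \<open>r \<in> I\<close>] energy_integrable[OF \<open>r \<in> I\<close>]
          _ bound[OF r] \<open>0 \<le> D\<close>] M[OF r] by (simp add: energy_def)
  qed (use k J on in \<open>simp_all add: case_prod_beta\<close>)
qed

section \<open>The three conservation laws\<close>

lemma mean_conserved:
  assumes "s \<in> I" "t \<in> I" "s < t" and M: "\<And>r. r \<in> {s..t} \<Longrightarrow> energy r \<le> M" and "1 \<le> M"
    and "integrable lborel (u s)" "integrable lborel (u t)"
  shows "(LINT x|lborel. u s x) = (LINT x|lborel. u t x)"
proof (rule conserved_while_energy_bounded[OF assms(1-4), where k = ut and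
      J = "\<lambda>r x. w r x - (u r x)\<^sup>2 / 2" and C = "3 * M\<^sup>2" and D = 0])
  fix r x assume r: "r \<in> I"
  show "((\<lambda>r. u r x) has_real_derivative ut r x) (at r within I)" using time_derivs(1)[OF r] .
  show "((\<lambda>x. w r x - (u r x)\<^sup>2 / 2) has_real_derivative ut r x) (at x)"
    by (auto intro!: derivative_eq_intros w_deriv[OF r] space_derivs[OF r] simp: wx_def)
next
  fix r F assume "r \<in> I" "F = at_top \<or> F = (at_bot :: real filter)"
  then show "((\<lambda>x. w r x - (u r x)\<^sup>2 / 2) \<longlongrightarrow> 0) F"
    by - (rule tendsto_eq_intros refl w_vanishes jets_vanish | assumption | simp)+
next
  fix r x assume r: "r \<in> {s..t}"
  then have "r \<in> I" using subinterval assms by blast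
  note b = pointwise_bounds[OF this M[OF r] \<open>1 \<le> M\<close>, of x]
  have "(u r x)\<^sup>2 \<le> M\<^sup>2" using power_mono[OF b(1), of 2] by simp
  then show "\<bar>w r x - (u r x)\<^sup>2 / 2\<bar> \<le> 3 * M\<^sup>2 + 0 * energy_density r x"
    using b(2) zero_le_power2[of "u r x"] zero_le_power2[of M] by linarith
qed (use assms in \<open>auto intro!: continuous_intros uncurried_continuous w_continuous\<close>)

text \<open>
  In the original variables the flux is \<open>2 u u_tx + 2 u\<^sup>2 u_xx - 3 u\<^sup>4 / 2\<close>, which results from multiplying the
  equation by \<open>2 u\<close>. Written with \<open>w\<close> it contains no derivative that the energy does not control.
\<close>

lemma energy_conserved:
  assumes "s \<in> I" "t \<in> I" "s < t" and M: "\<And>r. r \<in> {s..t} \<Longrightarrow> energy r \<le> M" and "1 \<le> M"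
  shows "energy s = energy t"
  unfolding energy_def
proof (rule conserved_while_energy_bounded[OF assms(1-4), where
      k = "\<lambda>r x. 2 * (u r x * ut r x + ux r x * utx r x)" and
      J = "\<lambda>r x. 2 * u r x * w r x - (u r x)^3 + (u r x)^4 / 2 - u r x * (ux r x)\<^sup>2" and
      C = "4 * M^3 + M^3 + M^4 / 2" and D = M])
  fix r x assume r: "r \<in> I"
  show "((\<lambda>r. energy_density r x) has_real_derivative 2 * (u r x * ut r x + ux r x * utx r x)) (at r within I)"
    by (auto intro!: derivative_eq_intros time_derivs[OF r])
  show "((\<lambda>x. 2 * u r x * w r x - (u r x)^3 + (u r x)^4 / 2 - u r x * (ux r x)\<^sup>2)
      has_real_derivative 2 * (u r x * ut r x + ux r x * utx r x)) (at x)"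
    by (rule derivative_eq_intros refl numeral_neq_zero w_deriv[OF r] space_derivs[OF r])+
      (simp add: w_def wx_def field_simps power2_eq_square power3_eq_cube power4_eq_xxxx)
next
  fix r F assume "r \<in> I" "F = at_top \<or> F = (at_bot :: real filter)"
  then show "((\<lambda>x. 2 * u r x * w r x - (u r x)^3 + (u r x)^4 / 2 - u r x * (ux r x)\<^sup>2) \<longlongrightarrow> 0) F"
    by - (rule tendsto_eq_intros refl w_vanishes jets_vanish | assumption | simp)+
next
  fix r x assume r: "r \<in> {s..t}"
  then have "r \<in> I" using subinterval assms by blast
  note b = pointwise_bounds[OF this M[OF r] \<open>1 \<le> M\<close>, of x]
  have "\<bar>2 * u r x * w r x\<bar> \<le> 2 * M * (2 * M\<^sup>2)"
    unfolding abs_mult using b \<open>1 \<le> M\<close> by (intro mult_mono) auto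
  moreover have "\<bar>(u r x)^3\<bar> \<le> M^3" "\<bar>(u r x)^4\<bar> \<le> M^4"
    using power_mono[OF b(1), of 3] power_mono[OF b(1), of 4] by (simp_all add: power_abs)
  moreover have "\<bar>u r x * (ux r x)\<^sup>2\<bar> \<le> M * energy_density r x"
    unfolding abs_mult using b \<open>1 \<le> M\<close> by (intro mult_mono) auto
  moreover have "2 * M * (2 * M\<^sup>2) = 4 * M^3" by (simp add: power2_eq_square power3_eq_cube)
  ultimately show "\<bar>2 * u r x * w r x - (u r x)^3 + (u r x)^4 / 2 - u r x * (ux r x)\<^sup>2\<bar>
      \<le> 4 * M^3 + M^3 + M^4 / 2 + M * energy_density r x"
    by linarith
qed (use assms energy_integrable in \<open>auto intro!: continuous_intros uncurried_continuous w_continuous\<close>)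

lemma hamiltonian_integrable:
  assumes t: "t \<in> I" and "energy t \<le> M" and "1 \<le> M"
  shows "integrable lborel (\<lambda>x. 1/4 * (u t x)^4 + 1/2 * u t x * (ux t x)\<^sup>2)"
proof (rule Bochner_Integration.integrable_bound)
  show "integrable lborel (\<lambda>x. M\<^sup>2 * energy_density t x)"
    using energy_integrable[OF t] by (rule integrable_mult_right)
  have "continuous_on UNIV (\<lambda>x. 1/4 * (u t x)^4 + 1/2 * u t x * (ux t x)\<^sup>2)"
    by (intro continuous_intros continuous_on_slice[OF jointly_continuous(1)]
      continuous_on_slice[OF jointly_continuous(3)] t)
  then show "(\<lambda>x. 1/4 * (u t x)^4 + 1/2 * u t x * (ux t x)\<^sup>2) \<in> borel_measurable lborel"
    by (simp add: borel_measurable_continuous_onI)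
  show "AE x in lborel. norm (1/4 * (u t x)^4 + 1/2 * u t x * (ux t x)\<^sup>2) \<le> norm (M\<^sup>2 * energy_density t x)"
  proof (rule AE_I2)
    fix x
    note b = pointwise_bounds(1)[OF assms, of x]
    have "M \<le> M\<^sup>2" using \<open>1 \<le> M\<close> by (simp add: power2_eq_square)
    have "(u t x)\<^sup>2 \<le> M\<^sup>2" using power_mono[OF b, of 2] by simp
    then have "(u t x)\<^sup>2 * (u t x)\<^sup>2 \<le> M\<^sup>2 * (u t x)\<^sup>2" by (intro mult_right_mono) auto
    moreover have "\<bar>u t x * (ux t x)\<^sup>2\<bar> \<le> M\<^sup>2 * (ux t x)\<^sup>2"
      unfolding abs_mult using b \<open>M \<le> M\<^sup>2\<close> by (intro mult_mono) auto
    moreover have "(u t x)^4 = (u t x)\<^sup>2 * (u t x)\<^sup>2" by (simp add: power2_eq_square power4_eq_xxxx)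
    moreover have "0 \<le> M\<^sup>2 * (u t x)\<^sup>2" "0 \<le> M\<^sup>2 * (ux t x)\<^sup>2" "0 \<le> (u t x)\<^sup>2 * (u t x)\<^sup>2" by auto
    ultimately have "\<bar>1/4 * (u t x)^4 + 1/2 * (u t x * (ux t x)\<^sup>2)\<bar> \<le> M\<^sup>2 * (u t x)\<^sup>2 + M\<^sup>2 * (ux t x)\<^sup>2"
      by linarith
    then show "norm (1/4 * (u t x)^4 + 1/2 * u t x * (ux t x)\<^sup>2) \<le> norm (M\<^sup>2 * energy_density t x)"
      by (simp add: distrib_left mult.assoc)
  qed
qed

text \<open>
  Put \<open>F = u u_xx + u_x\<^sup>2 / 2 - u\<^sup>3\<close>. The variational derivative of the functional is \<open>- F\<close>, so the time derivative
  of the density is \<open>- F u_t\<close> up to the space derivative of \<open>u u_x u_t\<close>. With \<open>g = w - u\<^sup>2 / 2\<close> one has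
  \<open>g_x = u_t\<close> and \<open>F = g - u_tx\<close>, so \<open>- F u_t\<close> is the space derivative of \<open>u_t\<^sup>2 / 2 - g\<^sup>2 / 2\<close>. Substituting
  \<open>u_t = w_x - u u_x\<close> in the total flux gives the form used here.
\<close>

lemma hamiltonian_conserved:
  assumes "s \<in> I" "t \<in> I" "s < t" and M: "\<And>r. r \<in> {s..t} \<Longrightarrow> energy r \<le> M" and "1 \<le> M"
  shows "(LINT x|lborel. 1/4 * (u s x)^4 + 1/2 * u s x * (ux s x)\<^sup>2)
       = (LINT x|lborel. 1/4 * (u t x)^4 + 1/2 * u t x * (ux t x)\<^sup>2)"
proof (rule conserved_while_energy_bounded[OF assms(1-4), where
      k = "\<lambda>r x. (u r x)^3 * ut r x + 1/2 * ut r x * (ux r x)\<^sup>2 + u r x * ux r x * utx r x" and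
      J = "\<lambda>r x. (wx r x)\<^sup>2 / 2 - (w r x - (u r x)\<^sup>2 / 2)\<^sup>2 / 2 - (u r x)\<^sup>2 * (ux r x)\<^sup>2 / 2" and
      C = "(2 * M\<^sup>2)\<^sup>2 / 2 + (3 * M\<^sup>2)\<^sup>2 / 2" and D = "M\<^sup>2"])
  fix r x assume r: "r \<in> I"
  show "((\<lambda>r. 1/4 * (u r x)^4 + 1/2 * u r x * (ux r x)\<^sup>2) has_real_derivative
      (u r x)^3 * ut r x + 1/2 * ut r x * (ux r x)\<^sup>2 + u r x * ux r x * utx r x) (at r within I)"
    by (auto intro!: derivative_eq_intros time_derivs[OF r])
  show "((\<lambda>x. (wx r x)\<^sup>2 / 2 - (w r x - (u r x)\<^sup>2 / 2)\<^sup>2 / 2 - (u r x)\<^sup>2 * (ux r x)\<^sup>2 / 2) has_real_derivative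
      (u r x)^3 * ut r x + 1/2 * ut r x * (ux r x)\<^sup>2 + u r x * ux r x * utx r x) (at x)"
    by (rule derivative_eq_intros refl numeral_neq_zero w_deriv[OF r] wx_deriv[OF r] space_derivs[OF r])+
      (simp add: w_def wx_def field_simps power2_eq_square power3_eq_cube)
next
  fix r F assume "r \<in> I" "F = at_top \<or> F = (at_bot :: real filter)"
  then show "((\<lambda>x. (wx r x)\<^sup>2 / 2 - (w r x - (u r x)\<^sup>2 / 2)\<^sup>2 / 2 - (u r x)\<^sup>2 * (ux r x)\<^sup>2 / 2) \<longlongrightarrow> 0) F"
    by - (rule tendsto_eq_intros refl w_vanishes jets_vanish | assumption | simp)+
next
  fix r x assume r: "r \<in> {s..t}"
  then have "r \<in> I" using subinterval assms by blast
  note b = pointwise_bounds[OF this M[OF r] \<open>1 \<le> M\<close>, of x]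
  have u2: "(u r x)\<^sup>2 \<le> M\<^sup>2" using power_mono[OF b(1), of 2] by simp
  have "\<bar>w r x - (u r x)\<^sup>2 / 2\<bar> \<le> 3 * M\<^sup>2"
    using b(2) u2 zero_le_power2[of "u r x"] zero_le_power2[of M] by linarith
  then have "(w r x - (u r x)\<^sup>2 / 2)\<^sup>2 \<le> (3 * M\<^sup>2)\<^sup>2" using power_mono[of _ _ 2] by fastforce
  moreover have "(wx r x)\<^sup>2 \<le> (2 * M\<^sup>2)\<^sup>2" using power_mono[OF b(3), of 2] by simp
  moreover have "(u r x)\<^sup>2 * (ux r x)\<^sup>2 \<le> M\<^sup>2 * energy_density r x"
    using u2 by (intro mult_mono) auto
  moreover have "0 \<le> (u r x)\<^sup>2 * (ux r x)\<^sup>2" by simp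
  moreover have "0 \<le> (wx r x)\<^sup>2" "0 \<le> (w r x - (u r x)\<^sup>2 / 2)\<^sup>2" by auto
  ultimately show "\<bar>(wx r x)\<^sup>2 / 2 - (w r x - (u r x)\<^sup>2 / 2)\<^sup>2 / 2 - (u r x)\<^sup>2 * (ux r x)\<^sup>2 / 2\<bar>
      \<le> (2 * M\<^sup>2)\<^sup>2 / 2 + (3 * M\<^sup>2)\<^sup>2 / 2 + M\<^sup>2 * energy_density r x"
    by linarith
next
  show "integrable lborel (\<lambda>x. 1/4 * (u s x)^4 + 1/2 * u s x * (ux s x)\<^sup>2)"
    "integrable lborel (\<lambda>x. 1/4 * (u t x)^4 + 1/2 * u t x * (ux t x)\<^sup>2)"
    using hamiltonian_integrable[OF _ M \<open>1 \<le> M\<close>] assms by auto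
qed (auto intro!: continuous_intros uncurried_continuous w_continuous)

section \<open>Constancy in time\<close>

text \<open>
  Fatou's lemma along a sequence of times; the density converges pointwise in \<open>x\<close> by joint continuity.
\<close>

lemma energy_lower_semicontinuous:
  assumes sub: "{a..b} \<subseteq> I"
  shows "closed {t\<in>{a..b}. energy t \<le> M}"
  unfolding closed_sequential_limits
proof (intro allI impI, elim conjE)
  fix T t assume T: "\<forall>n. T n \<in> {t\<in>{a..b}. energy t \<le> M}" and lim: "T \<longlonglongrightarrow> t"
  have nn: "(\<integral>\<^sup>+x. ennreal (energy_density r x) \<partial>lborel) = ennreal (energy r)" if "r \<in> I" for r
    unfolding energy_def using energy_integrable[OF that] by (rule nn_integral_eq_integral) auto
  have TI: "T n \<in> I" for n using T sub by blast
  have "t \<in> {a..b}" using closed_sequentially[OF closed_atLeastAtMost _ lim] T by blast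
  then have t: "t \<in> I" using sub by blast
  have pointwise: "(\<lambda>n. energy_density (T n) x) \<longlonglongrightarrow> energy_density t x" for x
  proof -
    have "continuous_on I (\<lambda>t. energy_density t x)"
      by (intro continuous_intros
          continuous_on_uncurried_compose[OF jointly_continuous(1) continuous_on_id continuous_on_const]
          continuous_on_uncurried_compose[OF jointly_continuous(3) continuous_on_id continuous_on_const])
    then show ?thesis
      by (rule continuous_on_tendsto_compose[OF _ lim t]) (simp add: TI)
  qed
  have "ennreal (energy t) = (\<integral>\<^sup>+x. liminf (\<lambda>n. ennreal (energy_density (T n) x)) \<partial>lborel)"
    unfolding nn[OF t, symmetric]
    by (intro nn_integral_cong lim_imp_Liminf[symmetric] tendsto_ennrealI pointwise) auto
  also have "\<dots> \<le> liminf (\<lambda>n. \<integral>\<^sup>+x. ennreal (energy_density (T n) x) \<partial>lborel)"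
    using energy_integrable[OF TI]
    by (intro nn_integral_liminf measurable_compose[OF borel_measurable_integrable measurable_ennreal])
  also have "\<dots> \<le> liminf (\<lambda>n::nat. ennreal M)"
    unfolding nn[OF TI] using T by (intro Liminf_mono always_eventually allI ennreal_leI) auto
  also have "\<dots> = ennreal M" by (simp add: Liminf_const)
  finally have "ennreal (energy t) \<le> ennreal M" .
  moreover have "0 \<le> energy (T 0)" unfolding energy_def by (rule Bochner_Integration.integral_nonneg) simp
  then have "0 \<le> M" using T order_trans by blast
  ultimately have "energy t \<le> M" by (simp add: ennreal_le_iff)
  then show "t \<in> {t\<in>{a..b}. energy t \<le> M}" using \<open>t \<in> {a..b}\<close> by blast
qed

lemma energy_constant:
  assumes "s \<in> I" "t \<in> I"
  shows "energy s = energy t"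
proof -
  have *: "energy a = energy b" if "a \<in> I" "b \<in> I" "a < b" for a b
  proof (rule constant_if_lsc_and_constant_where_bounded[OF \<open>a < b\<close> energy_lower_semicontinuous])
    show sub: "{a..b} \<subseteq> I" using that subinterval by blast
    show "energy r = energy r'"
      if "a \<le> r" "r < r'" "r' \<le> b" "\<And>\<tau>. \<tau> \<in> {r..r'} \<Longrightarrow> energy \<tau> \<le> M" for r r' M
    proof (rule energy_conserved)
      show "r \<in> I" "r' \<in> I" using that sub by auto
      show "energy \<tau> \<le> max 1 M" if "\<tau> \<in> {r..r'}" for \<tau>
        using \<open>\<And>\<tau>. \<tau> \<in> {r..r'} \<Longrightarrow> energy \<tau> \<le> M\<close>[OF that] by simp
    qed (use that in simp_all)
  qed
  show ?thesis
    by (rule linorder_cases[of s t]) (use *[OF assms(1,2)] *[OF assms(2,1)] in metis)+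
qed

lemma mean_constant:
  assumes "s \<in> I" "t \<in> I" and int: "\<And>t. t \<in> I \<Longrightarrow> integrable lborel (u t)"
  shows "(LINT x|lborel. u s x) = (LINT x|lborel. u t x)"
proof -
  have *: "(LINT x|lborel. u a x) = (LINT x|lborel. u b x)" if "a \<in> I" "b \<in> I" "a < b" for a b
  proof (rule mean_conserved[OF that])
    show "energy r \<le> max 1 (energy a)" if r: "r \<in> {a..b}" for r
      using energy_constant[OF \<open>a \<in> I\<close>, of r] subinterval[OF \<open>a \<in> I\<close> \<open>b \<in> I\<close>] r by force
  qed (simp_all add: int that)
  show ?thesis
    by (rule linorder_cases[of s t]) (use *[OF assms(1,2)] *[OF assms(2,1)] in metis)+
qed

lemma hamiltonian_constant:
  assumes "s \<in> I" "t \<in> I"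
  shows "(LINT x|lborel. 1/4 * (u s x)^4 + 1/2 * u s x * (ux s x)\<^sup>2)
       = (LINT x|lborel. 1/4 * (u t x)^4 + 1/2 * u t x * (ux t x)\<^sup>2)"
proof -
  have *: "(LINT x|lborel. 1/4 * (u a x)^4 + 1/2 * u a x * (ux a x)\<^sup>2)
       = (LINT x|lborel. 1/4 * (u b x)^4 + 1/2 * u b x * (ux b x)\<^sup>2)" if "a \<in> I" "b \<in> I" "a < b" for a b
  proof (rule hamiltonian_conserved[OF that])
    show "energy r \<le> max 1 (energy a)" if r: "r \<in> {a..b}" for r
      using energy_constant[OF \<open>a \<in> I\<close>, of r] subinterval[OF \<open>a \<in> I\<close> \<open>b \<in> I\<close>] r by force
  qed simp
  show ?thesis
    by (rule linorder_cases[of s t]) (use *[OF assms(1,2)] *[OF assms(2,1)] in metis)+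
qed

end

theorem corollary3p1:
  fixes u :: "real \<Rightarrow> real \<Rightarrow> real" and I :: "real set"
  assumes "is_interval I" and "0 \<in> I"
    and smooth: "C_on 3 I u"
    and solution: "solves_equation I u"
    and decay: "vanishes_at_infinity_upto 2 I u"
    and finite_energy: "\<And>t. t \<in> I \<Longrightarrow> integrable lborel (\<lambda>x. (u t x)\<^sup>2 + (deriv (u t) x)\<^sup>2)"
  shows "((\<forall>t\<in>I. integrable lborel (u t)) \<longrightarrow>
            (\<lambda>t. H0_functional (u t)) constant_on I \<and>
            (\<forall>t\<in>I. H0_functional (u t) = H0_functional (u 0)))
       \<and> (\<lambda>t. H_functional (u t)) constant_on I
       \<and> (\<forall>t\<in>I. H_functional (u t) = H_functional (u 0))
       \<and> (\<lambda>t. H1_functional (u t)) constant_on I"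
proof (cases "\<exists>a\<in>I. \<exists>b\<in>I. a < b")
  case False
  then have "t = 0" if "t \<in> I" for t
    using that \<open>0 \<in> I\<close> by (metis linorder_neqE_linordered_idom)
  then show ?thesis unfolding constant_on_def by blast
next
  case True
  then interpret decaying_solution u I
    using assms by unfold_locales auto
  have "H_functional (u t) = H_functional (u 0)" "H1_functional (u t) = H1_functional (u 0)"
    if "t \<in> I" for t
    using energy_constant[OF that \<open>0 \<in> I\<close>] hamiltonian_constant[OF that \<open>0 \<in> I\<close>]
    by (simp_all add: H_functional_def H1_functional_def energy_def pd_x_def)
  moreover have "H0_functional (u t) = H0_functional (u 0)"
    if "\<forall>t\<in>I. integrable lborel (u t)" "t \<in> I" for t
    using mean_constant[OF that(2) \<open>0 \<in> I\<close>] that(1) by (simp add: H0_functional_def)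
  ultimately show ?thesis unfolding constant_on_def by blast
qed

end
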